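(* Let $\Gamma$ be a finitely generated countably infinite group with a symmetric generating set $S$, not containing the identity, of finite size $d$. Let $Y$ be a standard Borel space and let $\mathcal{G}$ be the Schreier graph (with respect to $S$) induced by the free part of the shift action $\Gamma\curvearrowright Y^\Gamma$. Then $D_B(\mathcal{G})\le |Y|\times (d^2+1)^{d+1}$ (product of cardinals).
   Context: $Y^\Gamma$ carries the product Borel structure. The shift action is $(g\cdot x)(h)=x(hg)$. The free part is $X=\{x\in Y^\Gamma : g\cdot x\neq x \text{ for all } g\in\Gamma\setminus\{e\}\}$, where $e$ is the identity. The Schreier graph $\mathcal{G}=(X,E)$ has vertex set $X$ and edges $x\,E\,y \iff x\neq y$ and $s\cdot x=y$ for some $s\in S$. For a Borel graph $\mathcal{G}=(X,E)$ ($X$ a standard Borel space, $E\subseteq X\times X$ Borel, symmetric, irreflexive), a Borel distinguishing $Z$-coloring is a Borel map $c:X\to Z$ into a standard Borel space $Z$ such that $c\circ\psi\neq c$ for every non-identity graph automorphism $\psi$ of $\mathcal{G}$ (not necessarily Borel). The Borel distinguishing number $D_B(\mathcal{G})$ is the minimum cardinality $|Z|$ of a standard Borel space $Z$ for which a Borel distinguishing $Z$-coloring exists. *)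

theory Defs
  imports "HOL-Analysis.Analysis" "HOL-Algebra.Generated_Groups"
begin

unbundle cardinal_syntax

text \<open>
  As usual in HOL, a measurable space is represented by a value of type \<^typ>\<open>'a measure\<close> of which
  only the carrier \<^const>\<open>space\<close> and the sigma-algebra \<^const>\<open>sets\<close> matter.
\<close>

definition standard_borel :: "'a measure \<Rightarrow> bool" where
  "standard_borel M \<longleftrightarrow>
     (\<exists>T. completely_metrizable_space T \<and> separable_space T \<and> topspace T = space M \<and>
          sets M = sigma_sets (topspace T) {U. openin T U})"

text \<open>
  Automorphisms are arbitrary set-theoretic bijections of the vertex set; being different from the
  identity (or \<open>c \<circ> \<psi>\<close> being different from \<open>c\<close>) is always meant on the vertex set, since values of
  HOL functions outside it are irrelevant.
\<close>

definition graph_automorphism :: "'v set \<Rightarrow> ('v \<times> 'v) set \<Rightarrow> ('v \<Rightarrow> 'v) \<Rightarrow> bool" where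
  "graph_automorphism V E \<psi> \<longleftrightarrow>
     bij_betw \<psi> V V \<and> (\<forall>x\<in>V. \<forall>y\<in>V. (\<psi> x, \<psi> y) \<in> E \<longleftrightarrow> (x, y) \<in> E)"

definition borel_distinguishing_coloring ::
    "'v measure \<Rightarrow> ('v \<times> 'v) set \<Rightarrow> 'z measure \<Rightarrow> ('v \<Rightarrow> 'z) \<Rightarrow> bool" where
  "borel_distinguishing_coloring V E Z c \<longleftrightarrow>
     standard_borel Z \<and> c \<in> measurable V Z \<and>
     (\<forall>\<psi>. graph_automorphism (space V) E \<psi> \<and> (\<exists>x\<in>space V. \<psi> x \<noteq> x) \<longrightarrow>
          (\<exists>x\<in>space V. c (\<psi> x) \<noteq> c x))"

text \<open>
  The Borel distinguishing number is a cardinal, determined up to \<open>=o\<close>. A definition in HOL cannot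
  quantify over colour spaces of all types, so the carrier of \<open>Z\<close> is taken to be a set of reals. This
  loses nothing: a standard Borel space has at most continuum many points, so its structure can be
  transported to a set of reals. See the two lemmas \<open>borel_distinguishing_number_le\<close> and
  \<open>borel_distinguishing_number_attained\<close> below.
\<close>

definition distinguishing_cardinals :: "'v measure \<Rightarrow> ('v \<times> 'v) set \<Rightarrow> real rel set" where
  "distinguishing_cardinals V E =
     {|space Z| | (Z :: real measure) c. borel_distinguishing_coloring V E Z c}"

definition borel_distinguishing_number :: "'v measure \<Rightarrow> ('v \<times> 'v) set \<Rightarrow> real rel" where
  "borel_distinguishing_number V E =
     (SOME \<kappa>. \<kappa> \<in> distinguishing_cardinals V E \<and>
              (\<forall>\<kappa>'\<in>distinguishing_cardinals V E. \<kappa> \<le>o \<kappa>'))"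

definition shift :: "('g, 'b) monoid_scheme \<Rightarrow> 'g \<Rightarrow> ('g \<Rightarrow> 'y) \<Rightarrow> ('g \<Rightarrow> 'y)" where
  "shift G g x = (\<lambda>h\<in>carrier G. x (h \<otimes>\<^bsub>G\<^esub> g))"

definition shift_space :: "('g, 'b) monoid_scheme \<Rightarrow> 'y measure \<Rightarrow> ('g \<Rightarrow> 'y) measure" where
  "shift_space G Y = Pi\<^sub>M (carrier G) (\<lambda>_. Y)"

definition free_part :: "('g, 'b) monoid_scheme \<Rightarrow> 'y measure \<Rightarrow> ('g \<Rightarrow> 'y) measure" where
  "free_part G Y = restrict_space (shift_space G Y)
     {x \<in> space (shift_space G Y). \<forall>g\<in>carrier G - {\<one>\<^bsub>G\<^esub>}. shift G g x \<noteq> x}"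

definition schreier_edges ::
    "('g, 'b) monoid_scheme \<Rightarrow> 'g set \<Rightarrow> 'y measure \<Rightarrow> (('g \<Rightarrow> 'y) \<times> ('g \<Rightarrow> 'y)) set" where
  "schreier_edges G S Y =
     {(x, y). x \<in> space (free_part G Y) \<and> y \<in> space (free_part G Y) \<and>
              x \<noteq> y \<and> (\<exists>s\<in>S. shift G s x = y)}"


lemma standard_borel_inj_real:
  assumes "standard_borel (M :: 'a measure)"
  obtains f :: "'a \<Rightarrow> real" where "inj_on f (space M)"
proof -
  obtain T where T: "completely_metrizable_space T" "separable_space T" "topspace T = space M"
    using assms by (auto simp: standard_borel_def)
  from T(1) obtain A d where "Metric_space A d" and Td: "T = Metric_space.mtopology A d"
    unfolding completely_metrizable_space_def by blast
  interpret Metric_space A d by fact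
  have A: "A = space M" using T(3) Td by simp
  from T(2) obtain C where C: "countable C" "C \<subseteq> A" "mtopology closure_of C = A"
    unfolding separable_space_def Td by auto
  define F where "F x = {(q, n) \<in> C \<times> (UNIV :: nat set). d q x < 1 / Suc n}" for x
  have inj: "inj_on F A"
  proof (rule inj_onI, rule ccontr)
    fix x y assume xy: "x \<in> A" "y \<in> A" "F x = F y" "x \<noteq> y"
    then have "d x y / 2 > 0" by simp
    then obtain n where n: "1 / Suc n < d x y / 2"
      using nat_approx_posE by metis
    have "x \<in> mtopology closure_of C" using xy(1) C(3) by simp
    then have "\<forall>r>0. \<exists>q\<in>C. q \<in> mball x r" by (simp add: metric_closure_of)
    then have "\<exists>q\<in>C. q \<in> mball x (1 / Suc n)" by (metis of_nat_0_less_iff zero_less_Suc zero_less_divide_1_iff)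
    then obtain q where q: "q \<in> C" "d x q < 1 / Suc n" by auto
    then have "(q, n) \<in> F x" using C(2) xy by (auto simp: F_def commute)
    then have "d q y < 1 / Suc n" using xy(3) by (auto simp: F_def)
    moreover have "d x y \<le> d x q + d q y" using triangle q C(2) xy by blast
    ultimately show False using n q(2) by linarith
  qed
  have "countable (C \<times> (UNIV :: nat set))" using C(1) by simp
  then obtain h :: "_ \<Rightarrow> nat" where "inj_on h (C \<times> (UNIV :: nat set))"
    by (auto simp: countable_def)
  then have "inj_on (image h) (Pow (C \<times> (UNIV :: nat set)))" by (rule inj_on_image_Pow)
  then have "|Pow (C \<times> (UNIV :: nat set))| \<le>o |Pow (UNIV :: nat set)|"
    by (rule card_of_ordLeqI) simp
  moreover have "|A| \<le>o |Pow (C \<times> (UNIV :: nat set))|"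
    using inj by (intro card_of_ordLeqI[where f=F]) (auto simp: F_def)
  moreover have "|Pow (UNIV :: nat set)| \<le>o |UNIV :: real set|"
  proof -
    have "(UNIV :: nat set set) \<approx> (UNIV :: real set)"
      using nat_sets_eqpoll_reals by blast
    then show ?thesis
      unfolding eqpoll_def by (metis Pow_UNIV bij_betw_def card_of_ordLeqI rangeI)
  qed
  ultimately have "|A| \<le>o |UNIV :: real set|"
    by (meson ordLeq_transitive)
  then show thesis using that A by (metis card_of_ordLeq)
qed

lemma standard_borel_transport:
  assumes Z: "standard_borel (Z :: 'a measure)" and f: "inj_on f (space Z)"
  obtains Z' :: "'b measure" where "standard_borel Z'" "space Z' = f ` space Z"
    "f \<in> measurable Z Z'"
proof -
  obtain T where T: "completely_metrizable_space T" "separable_space T" "topspace T = space Z"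
    "sets Z = sigma_sets (topspace T) {U. openin T U}"
    using Z by (auto simp: standard_borel_def)
  define g where "g = inv_into (space Z) f"
  have gf: "g (f x) = x" if "x \<in> space Z" for x using that f by (simp add: g_def)
  define T' where "T' = pullback_topology (f ` space Z) g T"
  have op: "openin T' U \<longleftrightarrow> (\<exists>W. openin T W \<and> U = g -` W \<inter> f ` space Z)" for U
    by (simp add: T'_def openin_pullback_topology)
  have top: "topspace T' = f ` space Z"
    using gf T(3) by (auto simp: T'_def topspace_pullback_topology)
  have "homeomorphic_maps T T' f g"
    unfolding homeomorphic_maps_def
  proof (intro conjI ballI)
    show "continuous_map T T' f"
      unfolding T'_def
    proof (rule continuous_map_pullback')
      show "continuous_map T T (g \<circ> f)"
        by (rule continuous_map_eq[OF continuous_map_id]) (use gf T(3) in auto)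
    qed (use T(3) in auto)
    show "continuous_map T' T g"
      unfolding T'_def
      using continuous_map_pullback[OF continuous_map_id, of "f ` space Z" g T] by simp
  qed (use gf T(3) top in auto)
  then have hom: "T homeomorphic_space T'" by (auto simp: homeomorphic_space_def)
  have sub: "{U. openin T' U} \<subseteq> Pow (topspace T')" by (auto dest: openin_subset)
  define Z' where "Z' = sigma (topspace T') {U. openin T' U}"
  have sp: "space Z' = f ` space Z" and se: "sets Z' = sigma_sets (topspace T') {U. openin T' U}"
    using sub top by (simp_all add: Z'_def)
  have "completely_metrizable_space T'"
    using hom T(1) homeomorphic_completely_metrizable_space by blast
  moreover have "separable_space T'"
    using hom T(2) homeomorphic_separable_space by blast
  ultimately have "standard_borel Z'"
    unfolding standard_borel_def using sp se top by metis
  moreover have "f \<in> measurable Z Z'"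
    unfolding Z'_def
  proof (rule measurable_measure_of[OF sub])
    show "f \<in> space Z \<rightarrow> topspace T'" using top by auto
    fix U assume "U \<in> {U. openin T' U}"
    then obtain W where W: "openin T W" "U = g -` W \<inter> f ` space Z" using op by auto
    then have "f -` U \<inter> space Z = W" using gf T(3) openin_subset[OF W(1)] by force
    then show "f -` U \<inter> space Z \<in> sets Z" using W(1) T(4) by auto
  qed
  ultimately show thesis using that sp by blast
qed

lemma distinguishing_cardinals_complete:
  assumes "borel_distinguishing_coloring V E (Z :: 'z measure) c"
  shows "\<exists>\<kappa>\<in>distinguishing_cardinals V E. \<kappa> =o |space Z|"
proof -
  have Z: "standard_borel Z" and c: "c \<in> measurable V Z"
    using assms by (auto simp: borel_distinguishing_coloring_def)
  obtain f :: "'z \<Rightarrow> real" where f: "inj_on f (space Z)" using standard_borel_inj_real[OF Z] .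
  obtain Z' :: "real measure" where Z': "standard_borel Z'" "space Z' = f ` space Z"
    "f \<in> measurable Z Z'" using standard_borel_transport[OF Z f] .
  have "borel_distinguishing_coloring V E Z' (f \<circ> c)"
    unfolding borel_distinguishing_coloring_def
  proof (intro conjI allI impI)
    show "f \<circ> c \<in> measurable V Z'" using c Z'(3) by (rule measurable_comp)
    fix \<psi> assume a: "graph_automorphism (space V) E \<psi> \<and> (\<exists>x\<in>space V. \<psi> x \<noteq> x)"
    then obtain x where x: "x \<in> space V" "c (\<psi> x) \<noteq> c x"
      using assms unfolding borel_distinguishing_coloring_def by blast
    have "\<psi> x \<in> space V" using a x(1) by (auto simp: graph_automorphism_def bij_betw_def)
    then have "c x \<in> space Z" "c (\<psi> x) \<in> space Z"
      using x(1) measurable_space[OF c] by auto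
    then show "\<exists>x\<in>space V. (f \<circ> c) (\<psi> x) \<noteq> (f \<circ> c) x"
      using x f by (auto simp: inj_on_def intro!: bexI[of _ x])
  qed (use Z' in simp)
  moreover have "|space Z'| =o |space Z|"
    using f Z'(2) by (metis card_of_ordIso bij_betw_def ordIso_symmetric)
  ultimately show ?thesis unfolding distinguishing_cardinals_def by blast
qed

lemma borel_distinguishing_number_minimum:
  assumes "distinguishing_cardinals V E \<noteq> {}"
  shows "borel_distinguishing_number V E \<in> distinguishing_cardinals V E \<and>
    (\<forall>\<kappa>\<in>distinguishing_cardinals V E. borel_distinguishing_number V E \<le>o \<kappa>)"
proof -
  have "\<forall>r\<in>distinguishing_cardinals V E. Card_order r"
    by (auto simp: distinguishing_cardinals_def card_of_Card_order)
  with assms have "\<exists>\<kappa>. \<kappa> \<in> distinguishing_cardinals V E \<and>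
    (\<forall>\<kappa>'\<in>distinguishing_cardinals V E. \<kappa> \<le>o \<kappa>')"
    using exists_minim_Card_order by blast
  then show ?thesis unfolding borel_distinguishing_number_def by (rule someI_ex)
qed

lemma borel_distinguishing_number_le:
  assumes "borel_distinguishing_coloring V E (Z :: 'z measure) c"
  shows "borel_distinguishing_number V E \<le>o |space Z|"
  using distinguishing_cardinals_complete[OF assms] borel_distinguishing_number_minimum[of V E]
  by (metis empty_iff ordLeq_ordIso_trans)

lemma borel_distinguishing_number_attained:
  assumes "standard_borel V"
  shows "\<exists>(Z :: real measure) c. borel_distinguishing_coloring V E Z c \<and>
    borel_distinguishing_number V E = |space Z|"
proof -
  have "borel_distinguishing_coloring V E V (\<lambda>x. x)"
    using assms by (auto simp: borel_distinguishing_coloring_def)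
  then have "distinguishing_cardinals V E \<noteq> {}"
    using distinguishing_cardinals_complete by blast
  then have "borel_distinguishing_number V E \<in> distinguishing_cardinals V E"
    using borel_distinguishing_number_minimum by blast
  then show ?thesis unfolding distinguishing_cardinals_def by blast
qed

end

theory Submission
  imports Defs
begin

text \<open>
  Colour the free part in a Borel way by \<open>k\<close> with \<open>d\<^sup>2 + 1\<close> colours so that the neighbours
  \<open>s \<cdot> x\<close> (\<open>s \<in> S\<close>) of every point \<open>x\<close> receive different colours, and put
  \<open>c x = (x e, (k (s \<cdot> x))\<^sub>s)\<close> with \<open>s\<close> ranging over \<open>S \<union> {e}\<close>. If an automorphism \<open>\<psi>\<close> preserves \<open>c\<close>, then \<open>\<psi> (s \<cdot> x)\<close> and
  \<open>s \<cdot> \<psi> x\<close> are neighbours of \<open>\<psi> x\<close> with the same \<open>k\<close>-colour, hence equal. So \<open>\<psi>\<close> is equivariant,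
  and \<open>(\<psi> x) g = (g \<cdot> \<psi> x) e = (\<psi> (g \<cdot> x)) e = (g \<cdot> x) e = x g\<close>.

  The colouring \<open>k\<close> arises as in Kechris, Solecki and Todorcevic: a countable family separating
  points yields a Borel colouring with countably many colours, and recolouring its classes greedily
  one after the other needs only one colour more than the maximal degree.
\<close>

section \<open>Borel colourings of graphs of bounded degree\<close>

text \<open>All that the colouring argument asks of the space. It passes to countable products and
  to arbitrary subspaces, so it descends from \<open>Y\<close> to the free part directly. Since both
  orders of a pair are covered, either point can be the one inside the set.\<close>

definition countably_separated :: "'a measure \<Rightarrow> bool" where
  "countably_separated M \<longleftrightarrow> (\<exists>\<C>. countable \<C> \<and> \<C> \<subseteq> sets M \<and>
     (\<forall>x\<in>space M. \<forall>y\<in>space M. x \<noteq> y \<longrightarrow> (\<exists>A\<in>\<C>. x \<in> A \<and> y \<notin> A)))"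

lemma countably_separatedI:
  assumes "countable \<C>" "\<C> \<subseteq> sets M"
    "\<And>x y. x \<in> space M \<Longrightarrow> y \<in> space M \<Longrightarrow> x \<noteq> y \<Longrightarrow> \<exists>A\<in>\<C>. x \<in> A \<and> y \<notin> A"
  shows "countably_separated M"
  using assms unfolding countably_separated_def by auto

text \<open>Balls of radius \<open>1 / Suc n\<close> around a countable dense set form the
  separating family.\<close>

lemma standard_borel_countably_separated:
  assumes "standard_borel M"
  shows "countably_separated M"
proof -
  obtain T where T: "completely_metrizable_space T" "separable_space T" "topspace T = space M"
    "sets M = sigma_sets (topspace T) {U. openin T U}"
    using assms by (auto simp: standard_borel_def)
  from T(1) obtain A d where "Metric_space A d" and Td: "T = Metric_space.mtopology A d"
    unfolding completely_metrizable_space_def by blast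
  interpret Metric_space A d by fact
  have A: "A = space M" using T(3) Td by simp
  from T(2) obtain C where C: "countable C" "C \<subseteq> A" "mtopology closure_of C = A"
    unfolding separable_space_def Td by auto
  define \<C> where "\<C> = (\<lambda>(q, n). mball q (1 / Suc n)) ` (C \<times> (UNIV :: nat set))"
  have sep: "\<exists>B\<in>\<C>. x \<in> B \<and> y \<notin> B" if xy: "x \<in> A" "y \<in> A" "x \<noteq> y" for x y
  proof -
    have "d x y / 2 > 0" using xy by simp
    \<comment> \<open>A ball whose radius is below half of \<open>d x y\<close> cannot contain both
      points.\<close>
    then obtain n where n: "1 / Suc n < d x y / 2"
      using nat_approx_posE by metis
    have "x \<in> mtopology closure_of C" using xy(1) C(3) by simp
    then have "\<exists>q\<in>C. q \<in> mball x (1 / Suc n)"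
      by (simp add: metric_closure_of)
    then obtain q where q: "q \<in> C" "d x q < 1 / Suc n" by auto
    have "x \<in> mball q (1 / Suc n)" using q C(2) xy by (auto simp: commute)
    moreover have "y \<notin> mball q (1 / Suc n)"
    proof
      assume "y \<in> mball q (1 / Suc n)"
      moreover have "d x y \<le> d x q + d q y" using triangle q C(2) xy by blast
      ultimately show False using n q(2) by simp
    qed
    ultimately show ?thesis using q(1) unfolding \<C>_def by force
  qed
  have "countable \<C>" using C(1) by (simp add: \<C>_def)
  moreover have "\<C> \<subseteq> sets M" using T(4) Td by (auto simp: \<C>_def)
  ultimately show ?thesis using sep unfolding A by (rule countably_separatedI)
qed

text \<open>Distinct points of the product differ at some coordinate, so preimages of the given
  family under the countably many projections separate them.\<close>

lemma countably_separated_PiM: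
  assumes "countable I" "countably_separated M"
  shows "countably_separated (Pi\<^sub>M I (\<lambda>_. M))"
proof -
  obtain \<C> where \<C>: "countable \<C>" "\<C> \<subseteq> sets M"
    "\<forall>x\<in>space M. \<forall>y\<in>space M. x \<noteq> y \<longrightarrow> (\<exists>A\<in>\<C>. x \<in> A \<and> y \<notin> A)"
    using assms(2) unfolding countably_separated_def by (elim exE conjE)
  let ?P = "Pi\<^sub>M I (\<lambda>_. M)"
  define \<D> where "\<D> = (\<lambda>(i, A). (\<lambda>x. x i) -` A \<inter> space ?P) ` (I \<times> \<C>)"
  have sep: "\<exists>B\<in>\<D>. x \<in> B \<and> y \<notin> B" if xy: "x \<in> space ?P" "y \<in> space ?P" "x \<noteq> y" for x y
  proof -
    have "\<exists>i\<in>I. x i \<noteq> y i"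
      using xy by (metis PiE_ext space_PiM)
    then obtain i where i: "i \<in> I" "x i \<noteq> y i" by blast
    have "x i \<in> space M" "y i \<in> space M" using xy i by (auto simp: space_PiM)
    with \<C>(3) i obtain A where "A \<in> \<C>" "x i \<in> A" "y i \<notin> A" by blast
    then show ?thesis using i xy unfolding \<D>_def by force
  qed
  moreover have "countable \<D>" using assms(1) \<C>(1) by (simp add: \<D>_def)
  moreover have "\<D> \<subseteq> sets ?P"
  proof -
    have "(\<lambda>x. x i) -` A \<inter> space ?P \<in> sets ?P" if "i \<in> I" "A \<in> \<C>" for i A
      using measurable_component_singleton[OF that(1)] \<C>(2) that(2)
      by (blast intro: measurable_sets)
    then show ?thesis by (auto simp: \<D>_def)
  qed
  ultimately show ?thesis by (intro countably_separatedI)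
qed

lemma countably_separated_restrict_space:
  assumes "countably_separated M"
  shows "countably_separated (restrict_space M \<Omega>)"
proof -
  obtain \<C> where \<C>: "countable \<C>" "\<C> \<subseteq> sets M"
    "\<forall>x\<in>space M. \<forall>y\<in>space M. x \<noteq> y \<longrightarrow> (\<exists>A\<in>\<C>. x \<in> A \<and> y \<notin> A)"
    using assms unfolding countably_separated_def by (elim exE conjE)
  have "\<exists>B\<in>(\<inter>) \<Omega> ` \<C>. x \<in> B \<and> y \<notin> B"
    if "x \<in> space (restrict_space M \<Omega>)" "y \<in> space (restrict_space M \<Omega>)" "x \<noteq> y" for x y
    using \<C>(3)[rule_format, of x y] that by (auto simp: space_restrict_space)
  moreover have "countable ((\<inter>) \<Omega> ` \<C>)" "(\<inter>) \<Omega> ` \<C> \<subseteq> sets (restrict_space M \<Omega>)"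
    using \<C> by (auto simp: sets_restrict_space)
  ultimately show ?thesis by (intro countably_separatedI)
qed

text \<open>Finitely many sets of the separating family tell \<open>x\<close> apart from all its
  images \<open>f x\<close>. There are countably many finite subfamilies, and the colour of
  \<open>x\<close> is the least index of one that works. If \<open>f x\<close> had the same index,
  it would lie in all sets of that subfamily, yet it misses one of them.\<close>

lemma countable_borel_coloring:
  assumes M: "countably_separated M" and F: "finite F" "F \<subseteq> measurable M M"
    and nofix: "\<And>f x. f \<in> F \<Longrightarrow> x \<in> space M \<Longrightarrow> f x \<noteq> x"
  obtains n :: "'a \<Rightarrow> nat" where "n \<in> measurable M (count_space UNIV)"
    "\<And>f x. f \<in> F \<Longrightarrow> x \<in> space M \<Longrightarrow> n (f x) \<noteq> n x"
proof -
  obtain \<C> where \<C>: "countable \<C>" "\<C> \<subseteq> sets M"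
    "\<forall>x\<in>space M. \<forall>y\<in>space M. x \<noteq> y \<longrightarrow> (\<exists>A\<in>\<C>. x \<in> A \<and> y \<notin> A)"
    using M unfolding countably_separated_def by (elim exE conjE)
  have fM: "f x \<in> space M" if "f \<in> F" "x \<in> space M" for f x
    using F(2) that by (meson measurable_space subsetD)
  define \<A> where "\<A> = {B. finite B \<and> B \<subseteq> \<C>}"
  have \<A>: "countable \<A>" "\<A> \<noteq> {}"
    using \<C>(1) by (auto simp: \<A>_def countable_Collect_finite_subset)
  \<comment> \<open>The empty family belongs to \<open>\<A>\<close>, so \<open>from_nat_into\<close>
    enumerates exactly \<open>\<A>\<close>, possibly with repetitions.\<close>
  define e where "e = from_nat_into \<A>"
  have e: "finite (e i)" "e i \<subseteq> sets M" for i
    using from_nat_into[OF \<A>(2), of i] \<C>(2) by (auto simp: e_def \<A>_def)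
  define P where "P i x \<longleftrightarrow> (\<forall>A\<in>e i. x \<in> A) \<and> (\<forall>f\<in>F. \<not> (\<forall>A\<in>e i. f x \<in> A))" for i x
  define n where "n x = (LEAST i. P i x)" for x
  have P: "P (n x) x" if x: "x \<in> space M" for x
  proof -
    have "\<forall>f\<in>F. \<exists>A\<in>\<C>. x \<in> A \<and> f x \<notin> A"
      using \<C>(3) fM nofix x by metis
    then obtain A where A: "\<And>f. f \<in> F \<Longrightarrow> A f \<in> \<C> \<and> x \<in> A f \<and> f x \<notin> A f"
      by metis
    \<comment> \<open>One separating set is chosen for each \<open>f\<close>; finiteness of
      \<open>F\<close> makes this a member of \<open>\<A>\<close>.\<close>
    have "A ` F \<in> \<A>" using A F(1) by (auto simp: \<A>_def)
    then obtain i where "e i = A ` F"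
      using from_nat_into_surj[OF \<A>(1)] unfolding e_def by metis
    then have "P i x" using A unfolding P_def by blast
    then show ?thesis unfolding n_def by (rule LeastI)
  qed
  show thesis
  proof
    have "Measurable.pred M (P i)" for i
    proof -
      have 1: "Measurable.pred M (\<lambda>x. \<forall>A\<in>e i. x \<in> A)"
        using e by (intro pred_intros_finite pred_sets2[OF _ measurable_ident_sets]) auto
      then have "Measurable.pred M (\<lambda>x. \<forall>A\<in>e i. f x \<in> A)" if "f \<in> F" for f
        using measurable_compose[OF _ 1] F(2) that by blast
      then have "Measurable.pred M (\<lambda>x. \<forall>f\<in>F. \<not> (\<forall>A\<in>e i. f x \<in> A))"
        by (intro pred_intros_finite(3)[OF F(1)] pred_intros_logic(2))
      with 1 show ?thesis unfolding P_def by (intro pred_intros_logic(3))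
    qed
    then show "n \<in> measurable M (count_space UNIV)"
      unfolding n_def by (rule measurable_Least)
    fix f x assume fx: "f \<in> F" "x \<in> space M"
    show "n (f x) \<noteq> n x"
      using P[OF fx(2)] P[OF fM[OF fx]] fx(1) unfolding P_def by metis
  qed
qed

text \<open>
  \<open>m\<close> counts the stages: the class \<open>n x = m\<close> is recoloured in stage \<open>Suc m\<close>, so after \<open>m\<close> stages
  exactly the points with \<open>n x < m\<close> have their final colour.
\<close>

primrec greedy_coloring :: "('a \<Rightarrow> 'a) set \<Rightarrow> ('a \<Rightarrow> nat) \<Rightarrow> nat \<Rightarrow> 'a \<Rightarrow> nat" where
  "greedy_coloring F n 0 x = 0"
| "greedy_coloring F n (Suc m) x =
     (if n x = m then (LEAST j. \<forall>f\<in>F. n (f x) < m \<longrightarrow> greedy_coloring F n m (f x) \<noteq> j)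
      else greedy_coloring F n m x)"

lemma greedy_coloring_stable:
  "n x < m \<Longrightarrow> greedy_coloring F n m x = greedy_coloring F n (Suc (n x)) x"
  by (induction m) (auto simp: less_Suc_eq)

text \<open>Each stage is defined from the preceding one by a finite conjunction under a
  least-number operator, and both preserve measurability.\<close>

lemma measurable_greedy_coloring:
  assumes F: "finite F" "F \<subseteq> measurable M M" and [measurable]: "n \<in> measurable M (count_space UNIV)"
  shows "greedy_coloring F n m \<in> measurable M (count_space UNIV)"
proof (induction m)
  case (Suc m)
  note [measurable] = Suc
  have "Measurable.pred M (\<lambda>x. n (f x) < m \<longrightarrow> greedy_coloring F n m (f x) \<noteq> j)"
    if "f \<in> F" for f j
  proof -
    have [measurable]: "f \<in> measurable M M" using F(2) that by blast
    show ?thesis by measurable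
  qed
  then have "Measurable.pred M
      (\<lambda>x. \<forall>f\<in>F. n (f x) < m \<longrightarrow> greedy_coloring F n m (f x) \<noteq> j)" for j
    using F(1) by (intro pred_intros_finite) auto
  then have [measurable]: "(\<lambda>x. LEAST j. \<forall>f\<in>F. n (f x) < m \<longrightarrow> greedy_coloring F n m (f x) \<noteq> j)
      \<in> measurable M (count_space UNIV)"
    by (rule measurable_Least)
  show ?case unfolding greedy_coloring.simps by measurable
qed simp

text \<open>When \<open>x\<close> is recoloured, at most \<open>card F\<close> neighbours already
  have their final colour, so one of the \<open>card F + 1\<close> colours from \<open>0\<close> to
  \<open>card F\<close> is free. Neighbours never share a class of \<open>n\<close>, so one end of
  every edge is coloured strictly later and avoids the colour of the other.\<close>

lemma finite_borel_coloring:
  assumes M: "countably_separated M" and F: "finite F" "F \<subseteq> measurable M M"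
    and nofix: "\<And>f x. f \<in> F \<Longrightarrow> x \<in> space M \<Longrightarrow> f x \<noteq> x"
    and inverse: "\<And>f x. f \<in> F \<Longrightarrow> x \<in> space M \<Longrightarrow> \<exists>g\<in>F. g (f x) = x"
  obtains k :: "'a \<Rightarrow> nat" where "k \<in> measurable M (count_space UNIV)"
    "\<And>x. k x \<le> card F"
    "\<And>f x. f \<in> F \<Longrightarrow> x \<in> space M \<Longrightarrow> k (f x) \<noteq> k x"
proof -
  obtain n :: "'a \<Rightarrow> nat" where n[measurable]: "n \<in> measurable M (count_space UNIV)"
    and n_neq: "\<And>f x. f \<in> F \<Longrightarrow> x \<in> space M \<Longrightarrow> n (f x) \<noteq> n x"
    using countable_borel_coloring[OF M F] nofix by metis
  have fM: "f x \<in> space M" if "f \<in> F" "x \<in> space M" for f x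
    using F(2) that by (meson measurable_space subsetD)
  define k where "k x = greedy_coloring F n (Suc (n x)) x" for x
  define forbidden where "forbidden x = (\<lambda>f. k (f x)) ` {f \<in> F. n (f x) < n x}" for x
  have k: "k x = (LEAST j. j \<notin> forbidden x)" for x
  proof -
    \<comment> \<open>By stability, every neighbour with smaller \<open>n\<close> already carries
      its final value of \<open>k\<close> at stage \<open>n x\<close>; this turns the staged
      definition into a recursion for \<open>k\<close>.\<close>
    have "(\<forall>f\<in>F. n (f x) < n x \<longrightarrow> greedy_coloring F n (n x) (f x) \<noteq> j) \<longleftrightarrow> j \<notin> forbidden x" for j
      using greedy_coloring_stable[of n _ "n x" F] by (auto simp: forbidden_def k_def)
    then show ?thesis unfolding k_def by simp
  qed
  have card: "card (forbidden x) \<le> card F" "finite (forbidden x)" for x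
  proof -
    have "card (forbidden x) \<le> card {f \<in> F. n (f x) < n x}"
      unfolding forbidden_def using F(1) by (intro card_image_le) simp
    also have "\<dots> \<le> card F" using F(1) by (intro card_mono) auto
    finally show "card (forbidden x) \<le> card F" .
  qed (use F(1) in \<open>simp add: forbidden_def\<close>)
  have free: "\<exists>j\<le>card F. j \<notin> forbidden x" for x
  proof (rule ccontr)
    assume "\<not> ?thesis"
    then have "{..card F} \<subseteq> forbidden x" by auto
    then have "card {..card F} \<le> card (forbidden x)" using card(2) by (rule card_mono[rotated])
    with card(1)[of x] show False by simp
  qed
  have k_notin: "k x \<notin> forbidden x" for x
    unfolding k using free[of x] by (metis (mono_tags, lifting) LeastI)
  show thesis
  proof
    show "k \<in> measurable M (count_space UNIV)"
      unfolding k_def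
      \<comment> \<open>The stage \<open>Suc (n x)\<close> takes countably many values, so
        \<open>k\<close> is glued from countably many measurable maps along measurable
        pieces.\<close>
      by (rule measurable_compose_countable[where g="\<lambda>x. Suc (n x)"])
        (use measurable_greedy_coloring[OF F n] in measurable)
    show "k x \<le> card F" for x
      unfolding k using free[of x] by (meson Least_le le_trans)
    have earlier: "k (f x) \<noteq> k x" if "f \<in> F" "n (f x) < n x" for f x
    proof -
      have "k (f x) \<in> forbidden x" using that unfolding forbidden_def by blast
      with k_notin[of x] show ?thesis by metis
    qed
    fix f x assume fx: "f \<in> F" "x \<in> space M"
    show "k (f x) \<noteq> k x"
    proof (cases "n (f x) < n x")
      case False
      \<comment> \<open>Here \<open>f x\<close> is the later end, so the edge is read backwards,
        with the member of \<open>F\<close> that takes \<open>f x\<close> to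
        \<open>x\<close>.\<close>
      then have "n x < n (f x)" using n_neq[OF fx] by simp
      with inverse[OF fx] earlier[of _ "f x"] show ?thesis by metis
    qed (use fx earlier in blast)
  qed
qed

section \<open>The shift action\<close>

context group
begin

lemma shift_apply: "h \<in> carrier G \<Longrightarrow> shift G g x h = x (h \<otimes> g)"
  by (simp add: shift_def)

text \<open>Right translation of the argument gives a left action: both sides send \<open>u\<close>
  to \<open>x\<close> at \<open>u \<otimes> g \<otimes> h\<close>.\<close>

lemma shift_shift:
  assumes "g \<in> carrier G" "h \<in> carrier G"
  shows "shift G g (shift G h x) = shift G (g \<otimes> h) x"
  using assms by (auto simp: shift_def m_assoc intro!: restrict_ext)

lemma shift_one: "x \<in> extensional (carrier G) \<Longrightarrow> shift G \<one> x = x"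
  by (auto simp: shift_def extensional_def)

lemma space_free_part:
  "space (free_part G Y) =
     {x \<in> carrier G \<rightarrow>\<^sub>E space Y. \<forall>g\<in>carrier G - {\<one>}. shift G g x \<noteq> x}"
  by (auto simp: free_part_def shift_space_def space_restrict_space space_PiM)

lemma shift_one_free_part: "x \<in> space (free_part G Y) \<Longrightarrow> shift G \<one> x = x"
  by (auto simp: space_free_part PiE_def intro: shift_one)

text \<open>Stabilizers along an orbit are conjugate: if \<open>h\<close> fixes
  \<open>g \<cdot> x\<close>, then \<open>inv g \<otimes> h \<otimes> g\<close> fixes
  \<open>x\<close>.\<close>

lemma shift_free_part:
  assumes g: "g \<in> carrier G" and x: "x \<in> space (free_part G Y)"
  shows "shift G g x \<in> space (free_part G Y)"
proof -
  have "shift G g x \<in> carrier G \<rightarrow>\<^sub>E space Y"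
    using g x by (auto simp: space_free_part shift_def)
  moreover have "shift G h (shift G g x) \<noteq> shift G g x" if h: "h \<in> carrier G" "h \<noteq> \<one>" for h
  proof
    assume "shift G h (shift G g x) = shift G g x"
    then have "shift G (inv g) (shift G h (shift G g x)) = shift G (inv g) (shift G g x)" by simp
    then have "shift G (inv g \<otimes> (h \<otimes> g)) x = x"
      using g h x by (simp add: shift_shift shift_one_free_part)
    then have "inv g \<otimes> (h \<otimes> g) = \<one>" using g h x by (auto simp: space_free_part)
    then have "h \<otimes> g = g" using g h inv_solve_left[of \<one> g "h \<otimes> g"] by simp
    then show False using g h by simp
  qed
  ultimately show ?thesis by (auto simp: space_free_part)
qed

lemma shift_inj_free_part:
  assumes g: "g \<in> carrier G" and h: "h \<in> carrier G" and x: "x \<in> space (free_part G Y)"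
    and eq: "shift G g x = shift G h x"
  shows "g = h"
proof -
  have "shift G (inv h \<otimes> g) x = shift G (inv h) (shift G g x)"
    using g h by (simp add: shift_shift)
  also have "\<dots> = x" unfolding eq using h by (simp add: shift_shift shift_one_free_part[OF x])
  finally have "inv h \<otimes> g = \<one>" using g h x by (auto simp: space_free_part)
  then show ?thesis using g h inv_solve_left[of \<one> h g] by simp
qed

lemma measurable_shift_free_part:
  assumes g: "g \<in> carrier G"
  shows "shift G g \<in> measurable (free_part G Y) (free_part G Y)"
proof -
  have "shift G g \<in> measurable (Pi\<^sub>M (carrier G) (\<lambda>_. Y)) (Pi\<^sub>M (carrier G) (\<lambda>_. Y))"
    unfolding shift_def using g
    by (intro measurable_restrict measurable_component_singleton) simp
  then have "shift G g \<in> measurable (free_part G Y) (shift_space G Y)"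
    unfolding free_part_def shift_space_def by (rule measurable_restrict_space1)
  moreover have "shift G g \<in> space (free_part G Y) \<rightarrow> space (free_part G Y)"
    using shift_free_part[OF g] by auto
  ultimately show ?thesis
    by (subst (2) free_part_def, intro measurable_restrict_space2)
      (auto simp: free_part_def space_restrict_space)
qed

lemma countably_separated_free_part:
  assumes "countable (carrier G)" "standard_borel Y"
  shows "countably_separated (free_part G Y)"
  unfolding free_part_def shift_space_def
  using assms by (intro countably_separated_restrict_space countably_separated_PiM
      standard_borel_countably_separated)

text \<open>Since \<open>s \<cdot> x\<close> is the image of \<open>t \<cdot> x\<close> under the
  shift by \<open>s \<otimes> inv t\<close>, it suffices to colour properly the graph generated by
  these shifts for \<open>s \<noteq> t\<close>. There are at most \<open>(card S)\<^sup>2\<close> of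
  them, so the values from \<open>0\<close> to \<open>(card S)\<^sup>2\<close> are enough.\<close>

lemma neighbour_coloring:
  assumes "countable (carrier G)" "standard_borel Y" and S: "S \<subseteq> carrier G" "finite S"
  obtains k :: "('a \<Rightarrow> 'y) \<Rightarrow> nat" where "k \<in> measurable (free_part G Y) (count_space UNIV)"
    "\<And>x. k x \<le> (card S)\<^sup>2"
    "\<And>x s t. x \<in> space (free_part G Y) \<Longrightarrow> s \<in> S \<Longrightarrow> t \<in> S \<Longrightarrow>
       k (shift G s x) = k (shift G t x) \<Longrightarrow> s = t"
proof -
  let ?X = "free_part G Y"
  define P where "P = {(s, t) \<in> S \<times> S. s \<noteq> t}"
  define F :: "(('a \<Rightarrow> 'y) \<Rightarrow> ('a \<Rightarrow> 'y)) set" where "F = (\<lambda>(s, t). shift G (s \<otimes> inv t)) ` P"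
  have "P \<subseteq> S \<times> S" by (auto simp: P_def)
  moreover have "finite (S \<times> S)" using S(2) by simp
  ultimately have P: "finite P" "card P \<le> card (S \<times> S)"
    by (rule finite_subset, rule card_mono[rotated])
  have "card F \<le> card P" unfolding F_def by (rule card_image_le[OF P(1)])
  with P(2) have card: "card F \<le> (card S)\<^sup>2" by (simp add: power2_eq_square card_cartesian_product)
  have FE: "\<exists>s t. s \<in> carrier G \<and> t \<in> carrier G \<and> s \<in> S \<and> t \<in> S \<and> s \<noteq> t \<and> f = shift G (s \<otimes> inv t)"
    if "f \<in> F" for f
    using that S(1) by (auto simp: F_def P_def)
  obtain k where k: "k \<in> measurable ?X (count_space UNIV)" "\<And>x. k x \<le> card F"
    "\<And>f x. f \<in> F \<Longrightarrow> x \<in> space ?X \<Longrightarrow> k (f x) \<noteq> k x"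
  proof (rule finite_borel_coloring[OF countably_separated_free_part[OF assms(1,2)]])
    show "finite F" using P(1) by (simp add: F_def)
    show "F \<subseteq> measurable ?X ?X"
      using FE by (blast intro: measurable_shift_free_part m_closed inv_closed)
    show "f x \<noteq> x" if "f \<in> F" "x \<in> space ?X" for f x
    proof
      assume eq: "f x = x"
      obtain s t where st: "s \<in> carrier G" "t \<in> carrier G" "s \<noteq> t" "f = shift G (s \<otimes> inv t)"
        using FE[OF \<open>f \<in> F\<close>] by blast
      then have "shift G (s \<otimes> inv t) x = shift G \<one> x"
        using eq that by (simp add: shift_one_free_part)
      then have "s \<otimes> inv t = \<one>" using st that by (intro shift_inj_free_part) auto
      then show False using st inv_solve_right[of \<one> s t] by simp
    qed
    show "\<exists>g\<in>F. g (f x) = x" if "f \<in> F" "x \<in> space ?X" for f x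
    proof -
      obtain s t where st: "s \<in> carrier G" "t \<in> carrier G" "s \<in> S" "t \<in> S" "s \<noteq> t"
        "f = shift G (s \<otimes> inv t)"
        using FE[OF \<open>f \<in> F\<close>] by blast
      \<comment> \<open>The inverse of a shift in \<open>F\<close> comes from the swapped pair
        \<open>(t, s)\<close>, so it is again in \<open>F\<close>.\<close>
      have "t \<otimes> inv s \<otimes> (s \<otimes> inv t) = \<one>"
        using st inv_mult_group[of s "inv t"] l_inv[of "s \<otimes> inv t"] by simp
      then have "shift G (t \<otimes> inv s) (f x) = x"
        using st that by (simp add: shift_shift shift_one_free_part)
      moreover have "shift G (t \<otimes> inv s) \<in> F" using st by (force simp: F_def P_def)
      ultimately show ?thesis by blast
    qed
  qed blast
  show thesis
  proof
    show "k \<in> measurable ?X (count_space UNIV)" by fact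
    show "k x \<le> (card S)\<^sup>2" for x using k(2) card by (rule le_trans)
    fix x s t
    assume x: "x \<in> space ?X" and st: "s \<in> S" "t \<in> S" "k (shift G s x) = k (shift G t x)"
    have c: "s \<in> carrier G" "t \<in> carrier G" using st S(1) by auto
    show "s = t"
    proof (rule ccontr)
      assume "s \<noteq> t"
      then have "shift G (s \<otimes> inv t) \<in> F" using st by (force simp: F_def P_def)
      then have "k (shift G (s \<otimes> inv t) (shift G t x)) \<noteq> k (shift G t x)"
        using k(3) shift_free_part[OF c(2) x] by blast
      then show False using st c by (simp add: shift_shift m_assoc)
    qed
  qed
qed

text \<open>The table of colours around a point makes \<open>\<psi>\<close> commute with the
  generators, hence with the whole group. The coordinate at the identity, read along the orbit, then
  recovers every coordinate.\<close>

lemma preserving_automorphism_trivial: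
  assumes S: "S \<subseteq> carrier G" "\<And>s. s \<in> S \<Longrightarrow> inv s \<in> S" "\<one> \<notin> S" "generate G S = carrier G"
    and k: "\<And>x s t. x \<in> space (free_part G Y) \<Longrightarrow> s \<in> S \<Longrightarrow> t \<in> S \<Longrightarrow>
       k (shift G s x) = k (shift G t x) \<Longrightarrow> s = t"
    and \<psi>: "graph_automorphism (space (free_part G Y)) (schreier_edges G S Y) \<psi>"
    and pres: "\<And>x. x \<in> space (free_part G Y) \<Longrightarrow> \<psi> x \<one> = x \<one>"
      "\<And>x s. x \<in> space (free_part G Y) \<Longrightarrow> s \<in> S \<Longrightarrow> k (shift G s (\<psi> x)) = k (shift G s x)"
      "\<And>x. x \<in> space (free_part G Y) \<Longrightarrow> k (\<psi> x) = k x"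
    and x: "x \<in> space (free_part G Y)"
  shows "\<psi> x = x"
proof -
  let ?X = "space (free_part G Y)"
  have \<psi>X: "\<psi> y \<in> ?X" if "y \<in> ?X" for y
    using \<psi> that by (auto simp: graph_automorphism_def bij_betw_def)
  have equivariant_S: "\<psi> (shift G s y) = shift G s (\<psi> y)" if s: "s \<in> S" and y: "y \<in> ?X" for s y
  proof -
    have c: "s \<in> carrier G" "s \<noteq> \<one>" using s S by auto
    have sy: "shift G s y \<in> ?X" using c(1) y by (rule shift_free_part)
    \<comment> \<open>Freeness rules out a loop, so this really is an edge; its image is an edge at
      \<open>\<psi> y\<close>, labelled by some \<open>t\<close> still to be identified with
      \<open>s\<close>.\<close>
    have "shift G s y \<noteq> y" using c y by (auto simp: space_free_part)
    then have "(y, shift G s y) \<in> schreier_edges G S Y"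
      using s y sy by (auto simp: schreier_edges_def)
    then have "(\<psi> y, \<psi> (shift G s y)) \<in> schreier_edges G S Y"
      using \<psi> y sy by (simp add: graph_automorphism_def)
    then obtain t where t: "t \<in> S" "shift G t (\<psi> y) = \<psi> (shift G s y)"
      by (auto simp: schreier_edges_def)
    \<comment> \<open>The vertex \<open>s \<cdot> y\<close> links the two neighbours of
      \<open>\<psi> y\<close>: its own colour is preserved by \<open>\<psi>\<close>, and it also
      appears in the preserved table of \<open>y\<close>. Injectivity of \<open>k\<close> on
      neighbours then gives \<open>t = s\<close>.\<close>
    have "k (shift G t (\<psi> y)) = k (shift G s y)"
      using pres(3)[OF sy] t(2) by simp
    also have "\<dots> = k (shift G s (\<psi> y))" using pres(2)[OF y s] by simp
    finally have "t = s" using k[OF \<psi>X[OF y]] t(1) s by blast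
    with t(2) show ?thesis by simp
  qed
  have equivariant: "\<psi> (shift G g y) = shift G g (\<psi> y)" if "g \<in> generate G S" "y \<in> ?X" for g y
    using that
  proof (induction g arbitrary: y rule: generate.induct)
    case (one y)
    then show ?case using \<psi>X[of y] by (simp add: shift_one_free_part[of _ Y])
  next
    case (incl h)
    then show ?case by (rule equivariant_S)
  next
    case (inv h)
    then show ?case using S(2) equivariant_S by blast
  next
    case (eng g h)
    then have c: "g \<in> carrier G" "h \<in> carrier G" using S(4) by auto
    have "\<psi> (shift G (g \<otimes> h) y) = \<psi> (shift G g (shift G h y))"
      using c by (simp add: shift_shift)
    also have "\<dots> = shift G g (shift G h (\<psi> y))"
      by (simp only: eng.IH(1)[OF shift_free_part[OF c(2) eng.prems]] eng.IH(2)[OF eng.prems])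
    finally show ?case using c by (simp add: shift_shift)
  qed
  show ?thesis
  proof (rule PiE_ext)
    show "\<psi> x \<in> carrier G \<rightarrow>\<^sub>E space Y" "x \<in> carrier G \<rightarrow>\<^sub>E space Y"
      using x \<psi>X[OF x] by (auto simp: space_free_part)
    fix g assume g: "g \<in> carrier G"
    have "\<psi> x g = shift G g (\<psi> x) \<one>" using g by (simp add: shift_apply)
    also have "\<dots> = \<psi> (shift G g x) \<one>" using equivariant g x S(4) by simp
    also have "\<dots> = shift G g x \<one>" using g x by (intro pres(1) shift_free_part)
    finally show "\<psi> x g = x g" using g by (simp add: shift_apply)
  qed
qed

end

section \<open>The colour space\<close>

text \<open>\<open>Z\<close> carries the Borel structure of the product of a Polish topology on
  \<open>Y\<close> with the discrete topology on \<open>C\<close>. The last clause is the pairing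
  rule by which the final colouring becomes measurable.\<close>

lemma standard_borel_times_finite:
  assumes "standard_borel (Y :: 'y measure)" and C: "finite (C :: 'c set)"
  obtains Z :: "('y \<times> 'c) measure" where "standard_borel Z" "space Z = space Y \<times> C"
    "\<And>(M :: 'm measure) f q. f \<in> measurable M Y \<Longrightarrow> q \<in> measurable M (count_space C) \<Longrightarrow>
       (\<lambda>x. (f x, q x)) \<in> measurable M Z"
proof -
  obtain T where T: "completely_metrizable_space T" "separable_space T" "topspace T = space Y"
    "sets Y = sigma_sets (topspace T) {U. openin T U}"
    using assms by (auto simp: standard_borel_def)
  define T' where "T' = prod_topology T (discrete_topology C)"
  define Z where "Z = sigma (topspace T') {U. openin T' U}"
  have sub: "{U. openin T' U} \<subseteq> Pow (topspace T')" by (auto dest: openin_subset)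
  have top: "topspace T' = space Y \<times> C" by (simp add: T'_def T(3))
  have "completely_metrizable_space T'"
    unfolding T'_def using T(1)
    by (simp add: completely_metrizable_space_prod_topology completely_metrizable_space_discrete_topology)
  moreover have "separable_space T'"
  proof -
    obtain D where D: "countable D" "D \<subseteq> topspace T" "T closure_of D = topspace T"
      using T(2) unfolding separable_space_def by blast
    have "T' closure_of (D \<times> C) = topspace T'"
      unfolding T'_def by (simp add: closure_of_Times D(3) discrete_topology_closure_of)
    moreover have "countable (D \<times> C)" using D(1) C by (simp add: countable_finite)
    moreover have "D \<times> C \<subseteq> topspace T'" using D(2) by (auto simp: T'_def)
    ultimately show ?thesis unfolding separable_space_def by blast
  qed
  ultimately have "standard_borel Z"
    using sub unfolding standard_borel_def Z_def by auto
  moreover have "(\<lambda>x. (f x, q x)) \<in> measurable M Z"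
    if f: "f \<in> measurable M Y" and q: "q \<in> measurable M (count_space C)" for M :: "'m measure" and f q
    unfolding Z_def
  proof (rule measurable_measure_of[OF sub])
    have fq: "f x \<in> space Y" "q x \<in> C" if "x \<in> space M" for x
      using measurable_space[OF f that] measurable_space[OF q that] by auto
    then show "(\<lambda>x. (f x, q x)) \<in> space M \<rightarrow> topspace T'" using top by auto
    fix U assume "U \<in> {U. openin T' U}"
    then have U: "openin T' U" by simp
    \<comment> \<open>Slices of an open set are open, and finiteness of \<open>C\<close> makes the
      preimage of \<open>U\<close> a finite union over its slices.\<close>
    define V where "V j = {y \<in> topspace T. (y, j) \<in> U}" for j
    have V: "V j \<in> sets Y" if j: "j \<in> C" for j
    proof -
      have "continuous_map T T' (\<lambda>y. (y, j))"
        unfolding T'_def using j by (simp add: continuous_map_pairwise o_def)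
      then have "openin T (V j)" unfolding V_def using U by (rule openin_continuous_map_preimage)
      then show ?thesis using T(4) by auto
    qed
    have "(\<lambda>x. (f x, q x)) -` U \<inter> space M =
        (\<Union>j\<in>C. (f -` V j \<inter> space M) \<inter> (q -` {j} \<inter> space M))"
      using fq T(3) by (auto simp: V_def)
    also have "\<dots> \<in> sets M"
      using C by (intro sets.finite_UN sets.Int[OF measurable_sets[OF f V] measurable_sets[OF q]]) auto
    finally show "(\<lambda>x. (f x, q x)) -` U \<inter> space M \<in> sets M" .
  qed
  moreover have "space Z = space Y \<times> C" using sub top by (simp add: Z_def)
  ultimately show thesis using that by blast
qed

section \<open>The bound on the Borel distinguishing number\<close>

theorem theorem1p4:
  fixes G :: "('g, 'b) monoid_scheme" and S :: "'g set" and d :: nat and Y :: "'y measure"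
  assumes "group G" and "countable (carrier G)" and "infinite (carrier G)"
    and "S \<subseteq> carrier G" and "finite S" and "card S = d"
    and "\<And>s. s \<in> S \<Longrightarrow> inv\<^bsub>G\<^esub> s \<in> S" and "\<one>\<^bsub>G\<^esub> \<notin> S"
    and "generate G S = carrier G"
    and "standard_borel Y"
  shows "borel_distinguishing_number (free_part G Y) (schreier_edges G S Y)
           \<le>o |space Y| *c |{..<(d\<^sup>2 + 1) ^ (d + 1)}|"
proof -
  interpret group G by fact
  let ?X = "free_part G Y"
  obtain k :: "('g \<Rightarrow> 'y) \<Rightarrow> nat" where k: "k \<in> measurable ?X (count_space UNIV)"
    "\<And>x. k x \<le> d\<^sup>2"
    "\<And>x s t. x \<in> space ?X \<Longrightarrow> s \<in> S \<Longrightarrow> t \<in> S \<Longrightarrow>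
       k (shift G s x) = k (shift G t x) \<Longrightarrow> s = t"
    using neighbour_coloring[OF assms(2,10,4,5)] assms(6) by metis
  \<comment> \<open>Adding the identity to \<open>S\<close> makes the table record the colour of
    \<open>x\<close> itself. As the identity is outside \<open>S\<close>, there are
    \<open>d + 1\<close> entries with \<open>d\<^sup>2 + 1\<close> possible values each.\<close>
  define R where "R = insert \<one>\<^bsub>G\<^esub> S"
  have R: "finite R" "card R = d + 1" "R \<subseteq> carrier G" using assms by (auto simp: R_def)
  define C where "C = R \<rightarrow>\<^sub>E {..d\<^sup>2}"
  have C: "finite C" "card C = (d\<^sup>2 + 1) ^ (d + 1)"
    using R by (auto simp: C_def card_PiE finite_PiE)
  obtain Z :: "('y \<times> ('g \<Rightarrow> nat)) measure" where Z: "standard_borel Z" "space Z = space Y \<times> C"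
    "\<And>f q. f \<in> measurable ?X Y \<Longrightarrow> q \<in> measurable ?X (count_space C) \<Longrightarrow>
       (\<lambda>x. (f x, q x)) \<in> measurable ?X Z"
    using standard_borel_times_finite[OF assms(10) C(1)] by metis
  define q where "q x = (\<lambda>s\<in>R. k (shift G s x))" for x
  define c where "c x = (x \<one>\<^bsub>G\<^esub>, q x)" for x
  have q: "q \<in> measurable ?X (count_space C)"
  \<comment> \<open>For a finite target it is enough to check the fibres, and each fibre of
    \<open>q\<close> is a finite intersection of conditions on single entries.\<close>
  proof (subst measurable_count_space_eq2[OF C(1)], intro conjI ballI)
    show "q \<in> space ?X \<rightarrow> C" using k(2) by (auto simp: q_def C_def)
    fix a assume "a \<in> C"
    then have "q x = a \<longleftrightarrow> (\<forall>s\<in>R. k (shift G s x) = a s)" for x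
      by (auto simp: q_def C_def fun_eq_iff PiE_def extensional_def)
    then have "q -` {a} \<inter> space ?X = {x \<in> space ?X. \<forall>s\<in>R. k (shift G s x) = a s}" by auto
    also have "\<dots> \<in> sets ?X"
    proof -
      have "Measurable.pred ?X (\<lambda>x. k (shift G s x) = a s)" if "s \<in> R" for s
      proof -
        have [measurable]: "(\<lambda>x. k (shift G s x)) \<in> measurable ?X (count_space UNIV)"
          using R(3) that by (intro measurable_compose[OF measurable_shift_free_part k(1)]) auto
        show ?thesis by measurable
      qed
      then have "Measurable.pred ?X (\<lambda>x. \<forall>s\<in>R. k (shift G s x) = a s)"
        using R(1) by (intro pred_intros_finite)
      then show ?thesis by (simp add: pred_def)
    qed
    finally show "q -` {a} \<inter> space ?X \<in> sets ?X" .
  qed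
  have "(\<lambda>x. x \<one>\<^bsub>G\<^esub>) \<in> measurable ?X Y"
    unfolding free_part_def shift_space_def
    by (intro measurable_restrict_space1 measurable_component_singleton) simp
  then have c: "c \<in> measurable ?X Z"
    unfolding c_def using q by (rule Z(3))
  have "borel_distinguishing_coloring ?X (schreier_edges G S Y) Z c"
    unfolding borel_distinguishing_coloring_def
  proof (intro conjI allI impI Z(1) c)
    fix \<psi> assume \<psi>: "graph_automorphism (space ?X) (schreier_edges G S Y) \<psi> \<and>
      (\<exists>x\<in>space ?X. \<psi> x \<noteq> x)"
    show "\<exists>x\<in>space ?X. c (\<psi> x) \<noteq> c x"
    proof (rule ccontr)
      assume "\<not> ?thesis"
      then have eq: "c (\<psi> x) = c x" if "x \<in> space ?X" for x using that by blast
      have \<psi>X: "\<psi> x \<in> space ?X" if "x \<in> space ?X" for x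
        using \<psi> that by (auto simp: graph_automorphism_def bij_betw_def)
      have qeq: "k (shift G s (\<psi> x)) = k (shift G s x)" if "x \<in> space ?X" "s \<in> R" for x s
        using eq[OF that(1)] that(2) by (auto simp: c_def q_def dest: fun_cong[where x=s])
      have "\<psi> x = x" if "x \<in> space ?X" for x
      proof (rule preserving_automorphism_trivial[OF assms(4,7,8,9) k(3) _ _ _ _ that])
        show "k (\<psi> y) = k y" if "y \<in> space ?X" for y
          using qeq[OF that, of "\<one>\<^bsub>G\<^esub>"]
          by (simp add: R_def shift_one_free_part[OF that] shift_one_free_part[OF \<psi>X[OF that]])
      qed (use \<psi> eq qeq in \<open>auto simp: c_def R_def\<close>)
      with \<psi> show False by blast
    qed
  qed
  \<comment> \<open>The points of \<open>Z\<close> are pairs rather than reals;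
    \<open>borel_distinguishing_number_le\<close> accepts colour spaces of any type.\<close>
  then have "borel_distinguishing_number ?X (schreier_edges G S Y) \<le>o |space Y \<times> C|"
    using borel_distinguishing_number_le Z(2) by metis
  also have "|space Y \<times> C| \<le>o |space Y| *c |{..<(d\<^sup>2 + 1) ^ (d + 1)}|"
  proof -
    \<comment> \<open>\<open>C\<close> consists of functions, so its cardinal is compared with that
      of the initial segment of the naturals through a bijection.\<close>
    obtain h :: "('g \<Rightarrow> nat) \<Rightarrow> nat" where "bij_betw h C {..<(d\<^sup>2 + 1) ^ (d + 1)}"
      using C by (metis bij_betw_iff_card card_lessThan finite_lessThan)
    then have "|C| \<le>o |{..<(d\<^sup>2 + 1) ^ (d + 1)}|"
      by (intro card_of_ordLeqI[where f=h]) (auto simp: bij_betw_def)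
    then show ?thesis unfolding cprod_def Field_card_of by (rule card_of_Times_mono2)
  qed
  finally show ?thesis .
qed

end
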